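(* Let $p$ be prime. Let $u$ be a fixed point of a profinite substitution $\theta=\varprojlim\theta_\alpha$. Suppose that for each $\alpha\ge0$ the substitution $\theta_\alpha$ is length-$p$ and primitive. Then $(X_u,\sigma)$ is uniquely ergodic (there is exactly one $\sigma$-invariant Borel probability measure on $X_u$).
   Context: $\Sigma_p=\{0,\dots,p-1\}$. An inverse family of finite automata is a sequence $(\mathcal M_\alpha)_{\alpha\ge0}=(\mathcal S_\alpha,\Sigma_p,\delta_\alpha,\overline s_\alpha,\mathbb Z/(p^\alpha\mathbb Z),\tau_\alpha)_{\alpha\ge0}$ where $\mathcal S_\alpha$ is a finite set of states, $\overline s_\alpha\in\mathcal S_\alpha$ the initial state, $\delta_\alpha:\mathcal S_\alpha\times\Sigma_p\to\mathcal S_\alpha$ the transition function, $\tau_\alpha:\mathcal S_\alpha\to\mathbb Z/(p^\alpha\mathbb Z)$ the output function, together with maps $\psi_{\alpha,\beta}:\mathcal S_\beta\to\mathcal S_\alpha$ ($0\le\alpha\le\beta$) satisfying $\psi_{\alpha,\beta}(\overline s_\beta)=\overline s_\alpha$, $\psi_{\alpha,\beta}(\delta_\beta(s,i))=\delta_\alpha(\psi_{\alpha,\beta}(s),i)$, $\tau_\beta(s)\bmod p^\alpha=\tau_\alpha(\psi_{\alpha,\beta}(s))$ and $\psi_{\alpha,\gamma}=\psi_{\alpha,\beta}\circ\psi_{\beta,\gamma}$ for $\alpha\le\beta\le\gamma$. The automaton $\mathcal M_\alpha$ (with $\delta_\alpha(\overline s_\alpha,0)=\overline s_\alpha$) defines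 the length-$p$ substitution $\theta_\alpha$ on $\mathcal S_\alpha$, $\theta_\alpha(s)=\delta_\alpha(s,0)\delta_\alpha(s,1)\cdots\delta_\alpha(s,p-1)$. Let $\mathcal S=\varprojlim\mathcal S_\alpha=\{(s_\alpha)_\alpha\in\prod_\alpha\mathcal S_\alpha:\psi_{\alpha,\beta}(s_\beta)=s_\alpha\text{ for all }\alpha\le\beta\}$ with the inverse limit topology (each $\mathcal S_\alpha$ discrete). The profinite substitution $\theta=\varprojlim\theta_\alpha$ is the length-$p$ substitution $\theta:\mathcal S\to\mathcal S^p$ whose $i$-th letter is $\theta(s)_i=\varprojlim\theta_\alpha(s_\alpha)_i$, i.e. $(\theta(s)_i)_\alpha=\delta_\alpha(s_\alpha,i)$, for $0\le i\le p-1$. It extends to $\mathcal S^{\mathbb N}$ by concatenation, and a fixed point is $u\in\mathcal S^{\mathbb N}$ with $\theta(u)=u$. $\mathcal S^{\mathbb N}$ has the product topology, $\sigma$ is the shift $(x(n))_{n\geq 0}\mapsto(x(n+1))_{n\geq 0}$, and $X_u$ is the closure of $\{\sigma^n(u):n\in\mathbb N\}$. A substitution $\theta$ on a finite alphabet $\mathcal A$ is primitive if there is $k\in\mathbb N$ such that for all $a,a'\in\mathcal A$ the word $\theta^k(a)$ contains $a'$. *)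

theory Defs
  imports "HOL-Probability.Probability_Measure" "HOL-Computational_Algebra.Primes"
begin

section \<open>Substitutions of constant length\<close>

text \<open>
  A substitution sends each letter to a finite word; \<open>subst_word\<close> is its extension to finite
  words by concatenation.
\<close>

definition subst_word :: "('a \<Rightarrow> 'a list) \<Rightarrow> 'a list \<Rightarrow> 'a list" where
  "subst_word \<theta> w = concat (map \<theta> w)"

definition length_subst :: "nat \<Rightarrow> 'a set \<Rightarrow> ('a \<Rightarrow> 'a list) \<Rightarrow> bool" where
  "length_subst p A \<theta> \<longleftrightarrow> (\<forall>a\<in>A. length (\<theta> a) = p \<and> set (\<theta> a) \<subseteq> A)"

definition primitive_subst :: "'a set \<Rightarrow> ('a \<Rightarrow> 'a list) \<Rightarrow> bool" where
  "primitive_subst A \<theta> \<longleftrightarrow> (\<exists>k. \<forall>a\<in>A. \<forall>a'\<in>A. a' \<in> set ((subst_word \<theta> ^^ k) [a]))"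

text \<open>
  Extension of a length-\<open>p\<close> substitution to one-sided infinite words: in the infinite
  concatenation \<open>\<theta>(x(0)) \<theta>(x(1)) \<dots>\<close> of blocks of length \<open>p\<close>, position \<open>n\<close> lies in block
  \<open>n div p\<close> at offset \<open>n mod p\<close>.
\<close>

definition subst_seq :: "nat \<Rightarrow> ('a \<Rightarrow> 'a list) \<Rightarrow> (nat \<Rightarrow> 'a) \<Rightarrow> (nat \<Rightarrow> 'a)" where
  "subst_seq p \<theta> x = (\<lambda>n. \<theta> (x (n div p)) ! (n mod p))"

section \<open>Inverse families of finite automata\<close>

locale finite_automaton =
  fixes p :: nat
    and S :: "'s set"
    and \<delta> :: "'s \<Rightarrow> nat \<Rightarrow> 's"
    and s0 :: 's
    and Out :: "'o set"
    and \<tau> :: "'s \<Rightarrow> 'o"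
  assumes finite_states: "finite S"
    and initial_state: "s0 \<in> S"
    and transition: "\<delta> \<in> S \<rightarrow> ({..<p} \<rightarrow> S)"
    and output_map: "\<tau> \<in> S \<rightarrow> Out"

text \<open>
  All state sets \<open>S \<alpha>\<close> are finite subsets of one type, and \<open>\<int>/(p\<^sup>\<alpha>\<int>)\<close> is represented by its
  canonical residues \<open>{..<p ^ \<alpha>}\<close>. The condition \<open>initial_loop\<close> is the standing assumption under
  which an automaton is used to define a substitution.
\<close>

locale inverse_automata_family =
  fixes p :: nat
    and S :: "nat \<Rightarrow> 's set"
    and \<delta> :: "nat \<Rightarrow> 's \<Rightarrow> nat \<Rightarrow> 's"
    and s0 :: "nat \<Rightarrow> 's"
    and \<tau> :: "nat \<Rightarrow> 's \<Rightarrow> nat"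
    and \<psi> :: "nat \<Rightarrow> nat \<Rightarrow> 's \<Rightarrow> 's"
  assumes automaton: "\<And>\<alpha>. finite_automaton p (S \<alpha>) (\<delta> \<alpha>) (s0 \<alpha>) {..<p ^ \<alpha>} (\<tau> \<alpha>)"
    and initial_loop: "\<And>\<alpha>. \<delta> \<alpha> (s0 \<alpha>) 0 = s0 \<alpha>"
    and map_states: "\<And>\<alpha> \<beta>. \<alpha> \<le> \<beta> \<Longrightarrow> \<psi> \<alpha> \<beta> \<in> S \<beta> \<rightarrow> S \<alpha>"
    and map_initial: "\<And>\<alpha> \<beta>. \<alpha> \<le> \<beta> \<Longrightarrow> \<psi> \<alpha> \<beta> (s0 \<beta>) = s0 \<alpha>"
    and map_transition: "\<And>\<alpha> \<beta> s i. \<lbrakk>\<alpha> \<le> \<beta>; s \<in> S \<beta>; i < p\<rbrakk>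
          \<Longrightarrow> \<psi> \<alpha> \<beta> (\<delta> \<beta> s i) = \<delta> \<alpha> (\<psi> \<alpha> \<beta> s) i"
    and map_output: "\<And>\<alpha> \<beta> s. \<lbrakk>\<alpha> \<le> \<beta>; s \<in> S \<beta>\<rbrakk>
          \<Longrightarrow> \<tau> \<beta> s mod p ^ \<alpha> = \<tau> \<alpha> (\<psi> \<alpha> \<beta> s)"
    and map_comp: "\<And>\<alpha> \<beta> \<gamma> s. \<lbrakk>\<alpha> \<le> \<beta>; \<beta> \<le> \<gamma>; s \<in> S \<gamma>\<rbrakk>
          \<Longrightarrow> \<psi> \<alpha> \<gamma> s = \<psi> \<alpha> \<beta> (\<psi> \<beta> \<gamma> s)"

definition automaton_subst :: "nat \<Rightarrow> ('s \<Rightarrow> nat \<Rightarrow> 's) \<Rightarrow> 's \<Rightarrow> 's list" where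
  "automaton_subst p \<delta> s = map (\<delta> s) [0..<p]"

section \<open>Inverse limits and profinite substitutions\<close>

definition inverse_limit :: "(nat \<Rightarrow> 's set) \<Rightarrow> (nat \<Rightarrow> nat \<Rightarrow> 's \<Rightarrow> 's) \<Rightarrow> (nat \<Rightarrow> 's) set" where
  "inverse_limit S \<psi> =
     {s. (\<forall>\<alpha>. s \<alpha> \<in> S \<alpha>) \<and> (\<forall>\<alpha> \<beta>. \<alpha> \<le> \<beta> \<longrightarrow> \<psi> \<alpha> \<beta> (s \<beta>) = s \<alpha>)}"

definition inverse_limit_topology ::
    "(nat \<Rightarrow> 's set) \<Rightarrow> (nat \<Rightarrow> nat \<Rightarrow> 's \<Rightarrow> 's) \<Rightarrow> (nat \<Rightarrow> 's) topology" where
  "inverse_limit_topology S \<psi> =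
     subtopology (product_topology (\<lambda>\<alpha>. discrete_topology (S \<alpha>)) UNIV) (inverse_limit S \<psi>)"

definition profinite_subst ::
    "nat \<Rightarrow> (nat \<Rightarrow> 's \<Rightarrow> 's list) \<Rightarrow> (nat \<Rightarrow> 's) \<Rightarrow> (nat \<Rightarrow> 's) list" where
  "profinite_subst p \<theta> s = map (\<lambda>i. \<lambda>\<alpha>. \<theta> \<alpha> (s \<alpha>) ! i) [0..<p]"

section \<open>Shift spaces and unique ergodicity\<close>

definition shift :: "(nat \<Rightarrow> 'a) \<Rightarrow> (nat \<Rightarrow> 'a)" where
  "shift x = (\<lambda>n. x (Suc n))"

definition sequence_topology :: "'a topology \<Rightarrow> (nat \<Rightarrow> 'a) topology" where
  "sequence_topology T = product_topology (\<lambda>_. T) UNIV"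

definition orbit_closure_topology :: "'a topology \<Rightarrow> (nat \<Rightarrow> 'a) \<Rightarrow> (nat \<Rightarrow> 'a) topology" where
  "orbit_closure_topology T u =
     subtopology (sequence_topology T) (sequence_topology T closure_of {(shift ^^ n) u | n. True})"

definition borel_of :: "'a topology \<Rightarrow> 'a measure" where
  "borel_of T = sigma (topspace T) {U. openin T U}"

definition invariant_borel_prob :: "'a topology \<Rightarrow> ('a \<Rightarrow> 'a) \<Rightarrow> 'a measure \<Rightarrow> bool" where
  "invariant_borel_prob T f \<mu> \<longleftrightarrow>
     prob_space \<mu> \<and> sets \<mu> = sets (borel_of T) \<and> f \<in> measurable \<mu> \<mu> \<and> distr \<mu> \<mu> f = \<mu>"

definition uniquely_ergodic :: "'a topology \<Rightarrow> ('a \<Rightarrow> 'a) \<Rightarrow> bool" where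
  "uniquely_ergodic T f \<longleftrightarrow> (\<exists>!\<mu>. invariant_borel_prob T f \<mu>)"

end

theory Submission
  imports Defs
begin

text \<open>
  Fix a clopen set \<open>A\<close> that depends on finitely many letters at a finite level \<open>L\<close>, and let \<open>h k\<close> be
  the indicator of \<open>\<sigma>\<^sup>k u \<in> A\<close>. The mean of \<open>h\<close> over the block \<open>{p\<^sup>n j ..< p\<^sup>n (j + 1)}\<close> depends, up to
  \<open>L / p\<^sup>n\<close>, only on the level-\<open>L\<close> letter of \<open>u\<close> at \<open>j\<close>. If every letter occurs in each block of length
  \<open>r = p\<^sup>k\<close>, then two means of order \<open>n + k\<close> are averages of \<open>r\<close> means of order \<open>n\<close> that have one
  letter in common, so the oscillation \<open>d\<^sub>n\<close> of the block means satisfies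
  \<open>d\<^sub>n\<^sub>+\<^sub>k \<le> (1 - 1 / r) d\<^sub>n + L / (r p\<^sup>n)\<close>. It is nonincreasing, hence tends to \<open>0\<close>, and \<open>h\<close> has a mean
  that is uniform over all windows.

  These means form a content on the algebra of such clopen sets. By compactness it extends to an
  invariant measure, and invariance forces every invariant measure to agree with it on the algebra.
\<close>

section \<open>Uniform means of sequences with a block structure\<close>

text \<open>The threshold may not depend on the start \<open>m\<close> of the window. This
  uniformity carries the mean from \<open>u\<close> to every point of its orbit closure. The form
  without division also makes sense for \<open>N = 0\<close>.\<close>

definition has_uniform_mean :: "(nat \<Rightarrow> real) \<Rightarrow> real \<Rightarrow> bool" where
  "has_uniform_mean h c \<longleftrightarrow>
     (\<forall>\<epsilon>>0. \<exists>N\<^sub>0. \<forall>N\<ge>N\<^sub>0. \<forall>m. \<bar>(\<Sum>k<N. h (m + k)) - real N * c\<bar> \<le> \<epsilon> * real N)"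

definition block_mean :: "(nat \<Rightarrow> real) \<Rightarrow> nat \<Rightarrow> nat \<Rightarrow> real" where
  "block_mean h q j = (\<Sum>i<q. h (q * j + i)) / real q"

section \<open>Averages over aligned blocks and over arbitrary windows\<close>

lemma sum_lessThan_mult:
  fixes f :: "nat \<Rightarrow> 'a :: comm_monoid_add"
  shows "(\<Sum>i<q * r. f i) = (\<Sum>j<r. \<Sum>i<q. f (q * j + i))"
proof (induction r)
  case (Suc r)
  have "(\<Sum>i<q * Suc r. f i) = (\<Sum>i<q * r. f i) + (\<Sum>i=q * r..<q * r + q. f i)"
    by (metis atLeast0LessThan le_add1 mult_Suc_right add.commute sum.atLeastLessThan_concat zero_le)
  also have "(\<Sum>i=q * r..<q * r + q. f i) = (\<Sum>i<q. f (q * r + i))"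
    using sum.shift_bounds_nat_ivl[of f 0 "q * r" q] by (simp add: atLeast0LessThan add.commute)
  finally show ?case using Suc.IH by simp
qed simp

lemma block_mean_mult:
  assumes "q > 0"
  shows "block_mean h (q * r) j = (\<Sum>i<r. block_mean h q (r * j + i)) / real r"
proof -
  have "(\<Sum>i<q * r. h (q * r * j + i)) = (\<Sum>i<r. \<Sum>l<q. h (q * r * j + (q * i + l)))"
    by (rule sum_lessThan_mult)
  also have "\<dots> = (\<Sum>i<r. real q * block_mean h q (r * j + i))"
    using assms by (simp add: block_mean_def algebra_simps)
  finally show ?thesis
    using assms by (simp add: block_mean_def[of h "q * r"] sum_distrib_left[symmetric])
qed

lemma block_mean_bounds:
  assumes "\<And>k. 0 \<le> h k" "\<And>k. h k \<le> 1"
  shows "0 \<le> block_mean h q j" "block_mean h q j \<le> 1"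
proof -
  show "0 \<le> block_mean h q j"
    by (simp add: block_mean_def assms sum_nonneg)
  have "(\<Sum>i<q. h (q * j + i)) \<le> (\<Sum>i<q. 1)"
    by (intro sum_mono assms)
  then show "block_mean h q j \<le> 1"
    by (cases "q = 0") (simp_all add: block_mean_def)
qed

text \<open>Rounding both ends of the window down to multiples of \<open>q\<close> costs at most
  \<open>q\<close> each, because centred terms are bounded by 1. Between the rounded ends lie full
  blocks, whose centred sums are at most \<epsilon> per term.\<close>

lemma window_sum_bound:
  assumes q: "q > 0"
    and dev: "\<And>j. \<bar>block_mean h q j - c\<bar> \<le> \<epsilon>"
    and h: "\<And>k. \<bar>h k - c\<bar> \<le> 1"
  shows "\<bar>(\<Sum>k<N. h (m + k)) - real N * c\<bar> \<le> 2 * real q + \<epsilon> * (real N + real q)"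
proof -
  \<comment> \<open>Partial sums of the centred sequence: the window contributes
    \<open>H (m + N) - H m\<close>, so each end can be rounded separately.\<close>
  define H where "H M = (\<Sum>k<M. h k - c)" for M
  have \<epsilon>: "\<epsilon> \<ge> 0" using dev[of 0] by linarith
  have step: "\<bar>H (a + b) - H a\<bar> \<le> real b" for a b
  proof (induction b)
    case (Suc b)
    have "H (a + Suc b) = H (a + b) + (h (a + b) - c)" by (simp add: H_def)
    then show ?case using Suc.IH h[of "a + b"] by simp
  qed simp
  have rem: "\<bar>H M - H (q * (M div q))\<bar> \<le> real q" for M
  proof -
    have "\<bar>H (q * (M div q) + M mod q) - H (q * (M div q))\<bar> \<le> real (M mod q)" by (rule step)
    moreover have "M mod q \<le> q" using q by simp
    ultimately show ?thesis by simp
  qed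
  have H_block: "H (q * Suc j) - H (q * j) = real q * (block_mean h q j - c)" for j
  proof -
    have "H (q * r) = (\<Sum>j<r. \<Sum>i<q. h (q * j + i) - c)" for r
      unfolding H_def by (rule sum_lessThan_mult)
    from this[of "Suc j"] this[of j] show ?thesis
      using q by (simp add: block_mean_def sum_subtractf right_diff_distrib distrib_right)
  qed
  have blocks: "\<bar>H (q * (j + b)) - H (q * j)\<bar> \<le> \<epsilon> * real (q * b)" for j b
  proof (induction b)
    case (Suc b)
    have "\<bar>H (q * Suc (j + b)) - H (q * (j + b))\<bar> \<le> real q * \<epsilon>"
      unfolding H_block using dev[of "j + b"] by (simp add: abs_mult mult_left_mono)
    then show ?case using Suc.IH by (simp add: algebra_simps)
  qed simp
  \<comment> \<open>The number of blocks between the rounded ends. The first of them may start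
    before \<open>m\<close>, by less than \<open>q\<close>, so their total length is bounded by
    \<open>N + q\<close> and not by \<open>N\<close>.\<close>
  define b where "b = (m + N) div q - m div q"
  have div: "(m + N) div q = m div q + b"
    unfolding b_def by (simp add: div_le_mono)
  have "q * (m div q + b) \<le> m + N"
    using div by (metis mult.commute div_times_less_eq_dividend)
  moreover have "m < q * (m div q) + q"
    using mod_less_divisor[OF q, of m] mult_div_mod_eq[of q m] by linarith
  ultimately have "q * b \<le> N + q" unfolding distrib_left by linarith
  then have "\<epsilon> * real (q * b) \<le> \<epsilon> * (real N + real q)"
    using \<epsilon> by (intro mult_left_mono) linarith+
  moreover have "H (m + N) - H m = (\<Sum>k<N. h (m + k)) - real N * c"
  proof (induction N)
    case (Suc N)
    then show ?case by (simp add: H_def algebra_simps)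
  qed simp
  ultimately show ?thesis
    using blocks[of "m div q" b] rem[of m] rem[of "m + N"] unfolding div by linarith
qed

text \<open>Fix one block length at which all block means are close to \<open>c\<close>; the end
  effects of a window are then bounded independently of \<open>N\<close> and vanish relative to long
  windows.\<close>

lemma uniform_mean_if_block_means_converge:
  assumes p: "p \<ge> (2::nat)"
    and h: "\<And>k. 0 \<le> h k" "\<And>k. h k \<le> 1"
    and c: "0 \<le> c" "c \<le> 1"
    and dev: "\<And>n j. \<bar>block_mean h (p ^ n) j - c\<bar> \<le> D n"
    and D: "D \<longlonglongrightarrow> 0"
  shows "has_uniform_mean h c"
  unfolding has_uniform_mean_def
proof (intro allI impI)
  fix \<epsilon> :: real assume \<epsilon>: "\<epsilon> > 0"
  obtain n where n: "D n < \<epsilon> / 3"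
    using \<epsilon> D[THEN order_tendstoD(2), of "\<epsilon> / 3"] by (auto simp: eventually_sequentially)
  define q where "q = p ^ n"
  have q: "q > 0" using p by (simp add: q_def)
  \<comment> \<open>Chosen so that \<open>2 * q + \<epsilon> * q\<close>, which covers all terms
    that do not grow with \<open>N\<close>, is at most a third of
    \<open>\<epsilon> * N\<close>.\<close>
  obtain N\<^sub>0 :: nat where N0: "real N\<^sub>0 \<ge> 3 * (2 * real q + \<epsilon> * real q) / \<epsilon>"
    using real_arch_simple by blast
  show "\<exists>N\<^sub>0. \<forall>N\<ge>N\<^sub>0. \<forall>m. \<bar>(\<Sum>k<N. h (m + k)) - real N * c\<bar> \<le> \<epsilon> * real N"
  proof (intro exI[of _ N\<^sub>0] allI impI)
    fix N m assume N: "N \<ge> N\<^sub>0"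
    have "real N \<ge> 3 * (2 * real q + \<epsilon> * real q) / \<epsilon>"
      using N N0 by linarith
    then have N1: "3 * (2 * real q + \<epsilon> * real q) \<le> \<epsilon> * real N"
      using \<epsilon> by (simp add: field_simps)
    have "\<bar>block_mean h q j - c\<bar> \<le> \<epsilon> / 3" for j
      using dev[of n j] n by (simp add: q_def)
    moreover have "\<bar>h k - c\<bar> \<le> 1" for k
      using h[of k] c by linarith
    ultimately have "\<bar>(\<Sum>k<N. h (m + k)) - real N * c\<bar>
        \<le> 2 * real q + \<epsilon> / 3 * (real N + real q)"
      by (intro window_sum_bound[OF q])
    also have "\<dots> \<le> \<epsilon> * real N"
    proof -
      have "\<epsilon> * real q \<ge> 0" "\<epsilon> * real N \<ge> 0" using \<epsilon> by simp_all
      then show ?thesis using N1 unfolding distrib_left by linarith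
    qed
    finally show "\<bar>(\<Sum>k<N. h (m + k)) - real N * c\<bar> \<le> \<epsilon> * real N" .
  qed
qed

text \<open>Here \<open>w\<close> stands for the letters of \<open>u\<close> at one level and
  \<open>h\<close> for an observable reading \<open>L\<close> consecutive letters. The condition
  \<open>i + L \<le> p ^ n\<close> keeps these letters inside the block, which is determined by
  \<open>w j\<close>. Primitivity makes any two long blocks share a letter, and this contracts the
  spread of the block means.\<close>

lemma has_uniform_mean_if_primitive:
  fixes w :: "nat \<Rightarrow> 'a"
  assumes p: "p \<ge> (2::nat)"
    and h: "\<And>k. 0 \<le> h k" "\<And>k. h k \<le> 1"
    and local_rule: "\<And>n i j j'. w j = w j' \<Longrightarrow> i + L \<le> p ^ n \<Longrightarrow> h (p ^ n * j + i) = h (p ^ n * j' + i)"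
    and primitive: "\<And>j j'. \<exists>i<p ^ k. w (p ^ k * j' + i) = w j"
  shows "\<exists>c. has_uniform_mean h c"
proof -
  define B where "B n = block_mean h (p ^ n)" for n
  define Mx where "Mx n = (SUP j. B n j)" for n
  define Mn where "Mn n = (INF j. B n j)" for n
  have p0: "p > 0" and pr: "real p > 1" using p by auto
  have B01: "0 \<le> B n j" "B n j \<le> 1" for n j
    unfolding B_def using block_mean_bounds[of h] h by auto
  have "bdd_above (range (B n))" "bdd_below (range (B n))" for n
    using B01 by (auto intro!: bdd_aboveI[of _ 1] bdd_belowI[of _ 0])
  then have B_le: "B n j \<le> Mx n" and B_ge: "Mn n \<le> B n j" for n j
    by (auto simp: Mx_def Mn_def intro!: cSUP_upper cINF_lower)
  have Mx_least: "Mx n \<le> K" if "\<And>j. B n j \<le> K" for n K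
    unfolding Mx_def using that by (intro cSUP_least) auto
  have Mn_greatest: "K \<le> Mn n" if "\<And>j. K \<le> B n j" for n K
    unfolding Mn_def using that by (intro cINF_greatest) auto
  have B_add: "B (n + m) j = (\<Sum>i<p ^ m. B n (p ^ m * j + i)) / real (p ^ m)" for n m j
    unfolding B_def power_add using p0 by (intro block_mean_mult) simp
  \<comment> \<open>A block of order \<open>n + 1\<close> consists of \<open>p\<close> blocks of
    order \<open>n\<close>, and an average cannot leave the range of its terms.\<close>
  have "Mx (Suc n) \<le> Mx n" for n
  proof (rule Mx_least)
    fix j
    have "(\<Sum>i<p. B n (p * j + i)) \<le> (\<Sum>i<p. Mx n)" by (intro sum_mono B_le)
    then have "real p * B (Suc n) j \<le> real p * Mx n" using B_add[of n 1 j] p0 by simp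
    then show "B (Suc n) j \<le> Mx n" using p0 by simp
  qed
  then have Mx_dec: "decseq Mx" by (rule decseq_SucI)
  have "Mn n \<le> Mn (Suc n)" for n
  proof (rule Mn_greatest)
    fix j
    have "(\<Sum>i<p. Mn n) \<le> (\<Sum>i<p. B n (p * j + i))" by (intro sum_mono B_ge)
    then have "real p * Mn n \<le> real p * B (Suc n) j" using B_add[of n 1 j] p0 by simp
    then show "Mn n \<le> B (Suc n) j" using p0 by simp
  qed
  then have Mn_inc: "incseq Mn" by (rule incseq_SucI)
  have "0 \<le> Mx n" "Mn n \<le> 1" for n
    using B_le[of n 0] B_ge[of n 0] B01[of n 0] by linarith+
  then obtain c c' where c: "Mx \<longlonglongrightarrow> c" and c': "Mn \<longlonglongrightarrow> c'"
    using decseq_convergent[OF Mx_dec, of 0] incseq_convergent[OF Mn_inc, of 1] by metis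
  \<comment> \<open>Only positions at which the reading window overruns the block can contribute;
    there are at most \<open>L\<close> of them, each contributing at most 1.\<close>
  have same_letter: "B n j - B n j' \<le> real L / real p ^ n" if "w j = w j'" for n j j'
  proof -
    let ?q = "p ^ n"
    have "(\<Sum>i<?q. h (?q * j + i) - h (?q * j' + i)) \<le> (\<Sum>i<?q. if i + L \<le> ?q then 0 else 1)"
    proof (rule sum_mono)
      fix i
      show "h (?q * j + i) - h (?q * j' + i) \<le> (if i + L \<le> ?q then 0 else 1)"
        using local_rule[OF that, of i n] h(1)[of "?q * j' + i"] h(2)[of "?q * j + i"] by auto
    qed
    also have "\<dots> = real (card ({..<?q} \<inter> {i. \<not> i + L \<le> ?q}))"
      by (subst sum.If_cases) (auto simp: Collect_neg_eq)
    \<comment> \<open>Truncated subtraction covers the case of a block shorter than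
      \<open>L\<close>, where the interval is the whole block.\<close>
    also have "\<dots> \<le> real (card {?q - L..<?q})"
      by (intro of_nat_mono card_mono) auto
    also have "\<dots> \<le> real L"
      by (simp only: card_atLeastLessThan of_nat_le_iff)
    finally show ?thesis using p0
      by (simp add: B_def block_mean_def sum_subtractf diff_divide_distrib[symmetric] divide_right_mono)
  qed
  define r where "r = p ^ k"
  have r0: "r > 0" using p0 by (simp add: r_def)
  have contract: "Mx (n + k) - Mn (n + k) \<le> (real L / real p ^ n + (real r - 1) * (Mx n - Mn n)) / real r" for n
  proof -
    let ?K = "(real L / real p ^ n + (real r - 1) * (Mx n - Mn n)) / real r"
    have pair: "B (n + k) j - B (n + k) j' \<le> ?K" for j j'
    proof -
      \<comment> \<open>The letter that opens block \<open>j\<close> recurs at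
        \<open>i\<^sub>0\<close> in block \<open>j'\<close>. This matched pair is compared by
        \<open>same_letter\<close>, the other \<open>r - 1\<close> terms by the extremes
        \<open>Mx n\<close> and \<open>Mn n\<close>.\<close>
      obtain i\<^sub>0 where i0: "i\<^sub>0 < r" "w (r * j' + i\<^sub>0) = w (r * j)"
        using primitive[of j' "r * j"] by (auto simp: r_def)
      have "(\<Sum>i<r. B n (r * j + i)) = B n (r * j) + (\<Sum>i\<in>{..<r} - {0}. B n (r * j + i))"
        using r0 by (subst sum.remove[of _ 0]) auto
      also have "(\<Sum>i\<in>{..<r} - {0}. B n (r * j + i)) \<le> of_nat (card ({..<r} - {0})) * Mx n"
        by (intro sum_bounded_above B_le)
      finally have 1: "(\<Sum>i<r. B n (r * j + i)) \<le> B n (r * j) + (real r - 1) * Mx n"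
        using r0 by (simp add: of_nat_diff)
      have "(\<Sum>i<r. B n (r * j' + i)) = B n (r * j' + i\<^sub>0) + (\<Sum>i\<in>{..<r} - {i\<^sub>0}. B n (r * j' + i))"
        using i0 by (subst sum.remove[of _ i\<^sub>0]) auto
      moreover have "of_nat (card ({..<r} - {i\<^sub>0})) * Mn n \<le> (\<Sum>i\<in>{..<r} - {i\<^sub>0}. B n (r * j' + i))"
        by (intro sum_bounded_below B_ge)
      ultimately have 2: "B n (r * j' + i\<^sub>0) + (real r - 1) * Mn n \<le> (\<Sum>i<r. B n (r * j' + i))"
        using i0 r0 by (simp add: of_nat_diff)
      have "B n (r * j) - B n (r * j' + i\<^sub>0) \<le> real L / real p ^ n"
        using i0 by (intro same_letter) simp
      then have "(\<Sum>i<r. B n (r * j + i)) - (\<Sum>i<r. B n (r * j' + i))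
          \<le> real L / real p ^ n + (real r - 1) * (Mx n - Mn n)"
        using 1 2 unfolding right_diff_distrib by linarith
      then show ?thesis
        using r0 by (simp add: B_add r_def[symmetric] diff_divide_distrib[symmetric] divide_right_mono)
    qed
    \<comment> \<open>The bound holds for every pair of blocks, hence for the supremum against the
      infimum.\<close>
    have "Mx (n + k) - ?K \<le> Mn (n + k)"
    proof (rule Mn_greatest)
      fix j'
      have "Mx (n + k) \<le> ?K + B (n + k) j'"
        using pair by (intro Mx_least) (simp add: algebra_simps)
      then show "Mx (n + k) - ?K \<le> B (n + k) j'" by simp
    qed
    then show ?thesis by linarith
  qed
  have D_lim: "(\<lambda>n. Mx n - Mn n) \<longlonglongrightarrow> c - c'" by (intro tendsto_diff c c')
  have "(\<lambda>n. real L * (1 / real p) ^ n) \<longlonglongrightarrow> real L * 0"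
    using pr by (intro tendsto_mult tendsto_const LIMSEQ_realpow_zero) auto
  then have L_lim: "(\<lambda>n. real L / real p ^ n) \<longlonglongrightarrow> 0"
    by (simp add: power_one_over divide_inverse power_inverse)
  have "(\<lambda>n. (real L / real p ^ n + (real r - 1) * (Mx n - Mn n)) / real r)
      \<longlonglongrightarrow> (0 + (real r - 1) * (c - c')) / real r"
    using r0 by (intro tendsto_intros L_lim D_lim) auto
  moreover have "(\<lambda>n. Mx (n + k) - Mn (n + k)) \<longlonglongrightarrow> c - c'"
    using LIMSEQ_ignore_initial_segment[OF D_lim, of k] by simp
  \<comment> \<open>Both limits exist by monotonicity, so the contraction can be passed to the
    limit: the limiting gap is at most \<open>(r - 1) / r\<close> times itself and so cannot be
    positive.\<close>
  ultimately have "c - c' \<le> (0 + (real r - 1) * (c - c')) / real r"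
    using contract by (intro LIMSEQ_le) auto
  then have "c - c' \<le> 0" using r0 by (simp add: field_simps)
  moreover have "Mn n \<le> c'" "c \<le> Mx n" for n
    using incseq_le[OF Mn_inc c'] decseq_ge[OF Mx_dec c] by auto
  moreover have "c' \<le> c"
  proof (rule LIMSEQ_le[OF c' c])
    show "\<exists>N. \<forall>n\<ge>N. Mn n \<le> Mx n"
      using B_le B_ge order_trans by (metis (no_types))
  qed
  ultimately have cc: "c = c'" and between: "Mn n \<le> c" "c \<le> Mx n" for n
    by (auto intro: order_trans)
  have "has_uniform_mean h c"
  proof (rule uniform_mean_if_block_means_converge[OF p h, where D = "\<lambda>n. Mx n - Mn n"])
    have "Mx n \<le> 1" "0 \<le> Mn n" for n
      using B01 by (auto intro: Mx_least Mn_greatest)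
    then show "0 \<le> c" "c \<le> 1"
      using between[of 0] by (meson order_trans)+
    show "\<bar>block_mean h (p ^ n) j - c\<bar> \<le> Mx n - Mn n" for n j
      using B_le[of n j] B_ge[of n j] between[of n] unfolding B_def by linarith
    show "(\<lambda>n. Mx n - Mn n) \<longlonglongrightarrow> 0"
      using D_lim cc by simp
  qed
  then show ?thesis ..
qed

section \<open>Unique ergodicity from uniform means on a clopen algebra\<close>

text \<open>By invariance the number of visits to \<open>A\<close> in \<open>N\<close> steps has
  integral \<open>N * measure M A\<close>, while pointwise it stays within
  \<open>\<epsilon> * N\<close> of \<open>N * c\<close>. For each \<epsilon> a single positive
  \<open>N\<close> suffices.\<close>

lemma measure_eq_uniform_mean:
  assumes M: "prob_space M" "f \<in> measurable M M" "distr M M f = M"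
    and A: "A \<in> sets M"
    and mean: "\<And>\<epsilon>. \<epsilon> > 0 \<Longrightarrow> \<exists>N>0. \<forall>x\<in>space M.
      \<bar>(\<Sum>k<N. indicator A ((f ^^ k) x)) - real N * c\<bar> \<le> \<epsilon> * real N"
  shows "measure M A = c"
proof -
  interpret prob_space M by fact
  have fk: "f ^^ k \<in> measurable M M" for k
    by (rule measurable_compose_n[OF M(2)])
  \<comment> \<open>The induction writes the preimage under \<open>f ^^ Suc k\<close> as the
    preimage under \<open>f\<close> of the preimage under \<open>f ^^ k\<close>.\<close>
  have inv: "measure M ((f ^^ k) -` A \<inter> space M) = measure M A" for k
  proof (induction k)
    case 0
    then show ?case using A by (simp add: Int_absorb2 sets.sets_into_space)
  next
    case (Suc k)
    let ?B = "(f ^^ k) -` A \<inter> space M"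
    have B: "?B \<in> sets M" using fk A by (rule measurable_sets)
    have "measure M ((f ^^ Suc k) -` A \<inter> space M) = measure M (f -` ?B \<inter> space M)"
      using measurable_space[OF M(2)]
      by (intro arg_cong[of _ _ "measure M"]) (auto simp: funpow_Suc_right simp del: funpow.simps)
    also have "\<dots> = measure (distr M M f) ?B"
      by (rule measure_distr[OF M(2) B, symmetric])
    finally show ?case using Suc.IH M(3) by (simp del: funpow.simps)
  qed
  have "\<bar>measure M A - c\<bar> \<le> \<epsilon>" if \<epsilon>: "\<epsilon> > 0" for \<epsilon>
  proof -
    obtain N where N: "N > 0"
      and bnd: "\<And>x. x \<in> space M \<Longrightarrow>
        \<bar>(\<Sum>k<N. indicator A ((f ^^ k) x)) - real N * c\<bar> \<le> \<epsilon> * real N"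
      using mean[OF \<epsilon>] by auto
    let ?g = "\<lambda>x. \<Sum>k<N. indicator A ((f ^^ k) x) :: real"
    have meas: "(\<lambda>x. indicator A ((f ^^ k) x) :: real) \<in> borel_measurable M" for k
      using A by (intro measurable_compose[OF fk] borel_measurable_indicator)
    have int: "integrable M (\<lambda>x. indicator A ((f ^^ k) x) :: real)" for k
      by (rule integrable_const_bound[of _ 1]) (auto simp: meas simp del: indicator_simps split: split_indicator)
    have "(\<integral>x. indicator A ((f ^^ k) x) \<partial>M) = measure M A" for k
    proof -
      have "(\<integral>x. indicator A ((f ^^ k) x) \<partial>M) = (\<integral>x. indicator ((f ^^ k) -` A \<inter> space M) x \<partial>M :: real)"
        by (intro Bochner_Integration.integral_cong) (auto simp: indicator_def)
      then show ?thesis using inv[of k] by simp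
    qed
    then have g: "(\<integral>x. ?g x \<partial>M) = real N * measure M A"
      using int by simp
    have gi: "integrable M ?g" using int by simp
    have "(\<integral>x. ?g x \<partial>M) \<le> real N * c + \<epsilon> * real N"
      using bnd by (intro integral_le_const[OF gi] AE_I2) (auto simp: abs_le_iff algebra_simps)
    moreover have "real N * c - \<epsilon> * real N \<le> (\<integral>x. ?g x \<partial>M)"
      using bnd by (intro integral_ge_const[OF gi] AE_I2) (auto simp: abs_le_iff algebra_simps)
    ultimately have "real N * measure M A \<le> real N * (c + \<epsilon>)" "real N * (c - \<epsilon>) \<le> real N * measure M A"
      unfolding g by (simp_all add: algebra_simps)
    then show ?thesis using N by simp
  qed
  then show ?thesis
    by (metis abs_le_zero_iff dense_ge eq_iff_diff_eq_0)
qed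

lemma tendsto_mean:
  fixes h :: "nat \<Rightarrow> real"
  assumes "\<And>\<epsilon>. \<epsilon> > 0 \<Longrightarrow> \<exists>N\<^sub>0. \<forall>N\<ge>N\<^sub>0. \<bar>(\<Sum>k<N. h k) - real N * c\<bar> \<le> \<epsilon> * real N"
  shows "(\<lambda>N. (\<Sum>k<N. h k) / real N) \<longlonglongrightarrow> c"
proof (rule LIMSEQ_I)
  fix r :: real assume r: "r > 0"
  obtain N\<^sub>0 where N0: "\<And>N. N \<ge> N\<^sub>0 \<Longrightarrow> \<bar>(\<Sum>k<N. h k) - real N * c\<bar> \<le> r / 2 * real N"
    using assms[of "r / 2"] r by auto
  show "\<exists>no. \<forall>N\<ge>no. norm ((\<Sum>k<N. h k) / real N - c) < r"
  proof (intro exI[of _ "Suc N\<^sub>0"] allI impI)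
    fix N assume N: "N \<ge> Suc N\<^sub>0"
    have "(\<Sum>k<N. h k) / real N - c = ((\<Sum>k<N. h k) - real N * c) / real N"
      using N by (simp add: field_simps)
    moreover have "\<bar>(\<Sum>k<N. h k) - real N * c\<bar> < r * real N"
      using N0[of N] N r by (intro le_less_trans[OF N0[of N]]) auto
    ultimately show "norm ((\<Sum>k<N. h k) / real N - c) < r"
      using N by (simp add: divide_less_eq)
  qed
qed

text \<open>Members of \<open>M\<close> are clopen, since their complements also lie in
  \<open>M\<close>. This makes compactness applicable to the content of means, while
  \<open>generates\<close> lets \<open>M\<close> determine Borel measures.\<close>

lemma uniquely_ergodicI:
  fixes f :: "'a \<Rightarrow> 'a"
  assumes compact: "compact_space T"
    and nonempty: "topspace T \<noteq> {}"
    and alg: "algebra (topspace T) M"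
    and M_open: "\<And>A. A \<in> M \<Longrightarrow> openin T A"
    and generates: "\<And>U. openin T U \<Longrightarrow> U \<in> sigma_sets (topspace T) M"
    and f: "f \<in> topspace T \<rightarrow> topspace T"
    and preimage: "\<And>A. A \<in> M \<Longrightarrow> f -` A \<inter> topspace T \<in> M"
    and mean: "\<And>A. A \<in> M \<Longrightarrow> \<exists>c. \<forall>\<epsilon>>0. \<exists>N\<^sub>0. \<forall>N\<ge>N\<^sub>0. \<forall>x\<in>topspace T.
      \<bar>(\<Sum>k<N. indicator A ((f ^^ k) x)) - real N * c\<bar> \<le> \<epsilon> * real N"
  shows "uniquely_ergodic T f"
proof -
  define \<Omega> where "\<Omega> = topspace T"
  interpret algebra \<Omega> M using alg by (simp add: \<Omega>_def)
  obtain c where c: "\<And>A \<epsilon>. A \<in> M \<Longrightarrow> \<epsilon> > 0 \<Longrightarrow> \<exists>N\<^sub>0. \<forall>N\<ge>N\<^sub>0. \<forall>x\<in>\<Omega>.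
      \<bar>(\<Sum>k<N. indicator A ((f ^^ k) x)) - real N * c A\<bar> \<le> \<epsilon> * real N"
    using mean unfolding \<Omega>_def by metis
  have sets_borel: "sets (borel_of T) = sigma_sets \<Omega> M"
  proof -
    have "sets (borel_of T) = sigma_sets \<Omega> {U. openin T U}"
      unfolding borel_of_def \<Omega>_def by (rule sets_measure_of) (auto dest: openin_subset)
    also have "\<dots> = sigma_sets \<Omega> M"
      using M_open generates by (intro sigma_sets_eqI) (auto simp: \<Omega>_def)
    finally show ?thesis .
  qed
  obtain x\<^sub>0 where x0: "x\<^sub>0 \<in> \<Omega>" using nonempty unfolding \<Omega>_def by blast
  have fk: "(f ^^ k) x\<^sub>0 \<in> \<Omega>" for k
    by (induction k) (use x0 f in \<open>auto simp: \<Omega>_def\<close>)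
  \<comment> \<open>Visit frequencies along a single orbit. They are nonnegative, additive and
    eventually normalised, and these properties pass to their limit \<open>c\<close>.\<close>
  define avg where "avg A N = (\<Sum>k<N. indicator A ((f ^^ k) x\<^sub>0)) / real N" for A N
  have lim: "avg A \<longlonglongrightarrow> c A" if "A \<in> M" for A
    unfolding avg_def using c[OF that] x0 by (intro tendsto_mean) meson
  have c_nonneg: "0 \<le> c A" if "A \<in> M" for A
    by (rule LIMSEQ_le_const[OF lim[OF that]]) (auto simp: avg_def sum_nonneg)
  have c_empty: "c {} = 0"
  proof -
    have "avg {} = (\<lambda>_. 0)" by (simp add: avg_def fun_eq_iff)
    then show ?thesis using lim[of "{}"] by (simp add: LIMSEQ_const_iff)
  qed
  have c_space: "c \<Omega> = 1"
  proof -
    have "avg \<Omega> N = 1" if "N \<ge> 1" for N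
      using that fk by (simp add: avg_def indicator_def)
    then have "avg \<Omega> \<longlonglongrightarrow> 1"
      by (intro tendsto_eventually) (auto simp: eventually_sequentially)
    then show ?thesis by (rule LIMSEQ_unique[OF lim[OF top]])
  qed
  have c_Un: "c (A \<union> B) = c A + c B" if "A \<in> M" "B \<in> M" "A \<inter> B = {}" for A B
  proof -
    have "avg (A \<union> B) = (\<lambda>N. avg A N + avg B N)"
      using that(3)
      by (simp add: avg_def fun_eq_iff indicator_disj_union sum.distrib add_divide_distrib)
    then have "avg (A \<union> B) \<longlonglongrightarrow> c A + c B"
      using tendsto_add[OF lim lim] that by simp
    moreover have "A \<union> B \<in> M" using that by blast
    ultimately show ?thesis using LIMSEQ_unique lim by blast
  qed
  \<comment> \<open>Replacing \<open>A\<close> by its preimage moves the averaging window by one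
    step; the two averages differ by one boundary term divided by \<open>N\<close>.\<close>
  have c_preimage: "c (f -` A \<inter> \<Omega>) = c A" if A: "A \<in> M" for A
  proof -
    let ?h = "\<lambda>k. indicator A ((f ^^ k) x\<^sub>0) :: real"
    have pre: "f -` A \<inter> \<Omega> \<in> M" using preimage[OF A] by (simp add: \<Omega>_def)
    have "avg (f -` A \<inter> \<Omega>) = (\<lambda>N. avg A N + (?h N - ?h 0) * (1 / real N))"
    proof
      fix N
      have "indicator (f -` A \<inter> \<Omega>) ((f ^^ k) x\<^sub>0) = ?h (Suc k)" for k
        using fk[of k] by (simp add: indicator_def)
      moreover have "(\<Sum>k<N. ?h (Suc k)) = (\<Sum>k<N. ?h k) + (?h N - ?h 0)"
        using sum_lessThan_telescope[of ?h N] by (simp add: sum_subtractf)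
      ultimately show "avg (f -` A \<inter> \<Omega>) N = avg A N + (?h N - ?h 0) * (1 / real N)"
        by (simp add: avg_def add_divide_distrib diff_divide_distrib)
    qed
    moreover have "(\<lambda>N. (?h N - ?h 0) * (1 / real N)) \<longlonglongrightarrow> 0"
    proof (rule lim_null_mult_left_bounded)
      show "\<forall>\<^sub>F N in sequentially. norm (?h N - ?h 0) \<le> 1"
        by (auto simp: indicator_def)
    qed (rule lim_1_over_n)
    then have "(\<lambda>N. avg A N + (?h N - ?h 0) * (1 / real N)) \<longlonglongrightarrow> c A + 0"
      by (intro tendsto_add lim A)
    ultimately have "avg (f -` A \<inter> \<Omega>) \<longlonglongrightarrow> c A"
      by simp
    then show ?thesis by (rule LIMSEQ_unique[OF lim[OF pre]])
  qed
  have "\<exists>\<mu> :: 'a set \<Rightarrow> ennreal. (\<forall>A\<in>M. \<mu> A = ennreal (c A)) \<and> measure_space \<Omega> (sigma_sets \<Omega> M) \<mu>"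
  proof (rule caratheodory_empty_continuous)
    show "positive M (\<lambda>A. ennreal (c A))"
      by (simp add: positive_def c_empty)
    show "additive M (\<lambda>A. ennreal (c A))"
      by (simp add: additive_def c_Un c_nonneg ennreal_plus)
  next
    fix A :: "nat \<Rightarrow> 'a set"
    assume A: "range A \<subseteq> M" "decseq A" "(\<Inter>i. A i) = {}"
    \<comment> \<open>Decreasing closed sets with empty intersection in a compact space include an
      empty one, so the content is eventually 0 along the sequence. This is the continuity at the
      empty set that Caratheodory's extension requires.\<close>
    have "closedin T (A i)" for i
    proof -
      have "openin T (\<Omega> - A i)" using A by (intro M_open) auto
      moreover have "A i \<subseteq> \<Omega>" using A space_closed by auto
      ultimately show ?thesis by (simp add: closedin_def \<Omega>_def)
    qed
    then obtain n where "A n = {}"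
      using compact_space_imp_nest[OF compact _ _ A(2)] A(3) by auto
    then have "A i = {}" if "i \<ge> n" for i
      using decseqD[OF A(2) that] by simp
    then have "\<forall>i\<ge>n. ennreal (c (A i)) = 0" by (simp add: c_empty)
    then show "(\<lambda>i. ennreal (c (A i))) \<longlonglongrightarrow> 0"
      by (intro tendsto_eventually) (auto simp: eventually_sequentially)
  qed simp
  then obtain \<mu> :: "'a set \<Rightarrow> ennreal" where \<mu>: "\<And>A. A \<in> M \<Longrightarrow> \<mu> A = ennreal (c A)"
    and ms: "measure_space \<Omega> (sigma_sets \<Omega> M) \<mu>" by auto
  define K where "K = measure_of \<Omega> M \<mu>"
  have sets_K: "sets K = sigma_sets \<Omega> M" and space_K: "space K = \<Omega>"
    using space_closed by (auto simp: K_def)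
  have K: "emeasure K A = ennreal (c A)" if "A \<in> M" for A
  proof -
    have "emeasure K A = \<mu> A"
      by (rule emeasure_measure_of[OF K_def space_closed])
        (use ms that in \<open>auto simp: sets_K measure_space_def\<close>)
    then show ?thesis using \<mu>[OF that] by simp
  qed
  have f_meas: "f \<in> measurable N N" if "sets N = sigma_sets \<Omega> M" for N
  proof (rule measurable_sigma_sets[OF that space_closed])
    have "space N = \<Omega>" using that space_closed by (metis sets_K sets_eq_imp_space_eq space_K)
    then show "f \<in> space N \<rightarrow> \<Omega>" "\<And>A. A \<in> M \<Longrightarrow> f -` A \<inter> space N \<in> sets N"
      using f preimage that by (auto simp: \<Omega>_def)
  qed
  \<comment> \<open>\<open>M\<close> is stable under intersection and contains
    \<open>\<Omega>\<close>, which has finite measure, so equality on \<open>M\<close> extends to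
    the generated sigma-algebra.\<close>
  have determined: "N = N'"
    if "sets N = sigma_sets \<Omega> M" "sets N' = sigma_sets \<Omega> M"
      and "\<And>A. A \<in> M \<Longrightarrow> emeasure N A = ennreal (c A)" "\<And>A. A \<in> M \<Longrightarrow> emeasure N' A = ennreal (c A)"
    for N N'
    by (rule measure_eqI_generator_eq[where E = M and \<Omega> = \<Omega> and A = "\<lambda>_. \<Omega>"])
      (use that space_closed in \<open>auto simp: Int_stable_def\<close>)
  have "invariant_borel_prob T f K"
    unfolding invariant_borel_prob_def
  proof (intro conjI)
    show "prob_space K"
      by (rule prob_spaceI) (simp add: space_K K c_space)
    show "sets K = sets (borel_of T)" by (simp add: sets_K sets_borel)
    show fK: "f \<in> measurable K K" by (rule f_meas[OF sets_K])
    show "distr K K f = K"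
    proof (rule determined)
      fix A assume A: "A \<in> M"
      then have "emeasure (distr K K f) A = emeasure K (f -` A \<inter> \<Omega>)"
        using emeasure_distr[OF fK] by (simp add: sets_K space_K sigma_sets.Basic)
      then show "emeasure (distr K K f) A = ennreal (c A)"
        using K preimage[OF A] c_preimage[OF A] by (simp add: \<Omega>_def)
    qed (simp_all add: sets_K K)
  qed
  moreover have "N = K" if N: "invariant_borel_prob T f N" for N
  proof (rule determined)
    show sets_N: "sets N = sigma_sets \<Omega> M"
      using N by (simp add: invariant_borel_prob_def sets_borel)
    have space_N: "space N = \<Omega>"
      using sets_N sets_K space_K by (metis sets_eq_imp_space_eq)
    interpret N: prob_space N using N by (simp add: invariant_borel_prob_def)
    fix A assume A: "A \<in> M"
    have "measure N A = c A"
    proof (rule measure_eq_uniform_mean[OF N.prob_space_axioms])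
      show "f \<in> measurable N N" "distr N N f = N"
        using N by (auto simp: invariant_borel_prob_def)
      show "A \<in> sets N" using A by (simp add: sets_N sigma_sets.Basic)
      fix \<epsilon> :: real assume "\<epsilon> > 0"
      then obtain N\<^sub>0 where "\<forall>n\<ge>N\<^sub>0. \<forall>x\<in>\<Omega>.
          \<bar>(\<Sum>k<n. indicator A ((f ^^ k) x)) - real n * c A\<bar> \<le> \<epsilon> * real n"
        using c[OF A] by blast
      then show "\<exists>n>0. \<forall>x\<in>space N.
          \<bar>(\<Sum>k<n. indicator A ((f ^^ k) x)) - real n * c A\<bar> \<le> \<epsilon> * real n"
        \<comment> \<open>The successor makes the number of steps positive.\<close>
        unfolding space_N by (intro exI[of _ "Suc N\<^sub>0"]) (simp del: sum.lessThan_Suc of_nat_Suc)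
    qed
    then show "emeasure N A = ennreal (c A)" by (simp add: N.emeasure_eq_measure)
  qed (simp_all add: sets_K K)
  ultimately show ?thesis unfolding uniquely_ergodic_def by (intro ex1I[of _ K])
qed

section \<open>Orbit closures of sequences over an inverse limit\<close>

text \<open>
  One index bounds both the number of letters compared and the level of the comparison: by
  compatibility, agreement at level \<open>L\<close> entails agreement at all lower levels.
\<close>

definition agree :: "nat \<Rightarrow> (nat \<Rightarrow> nat \<Rightarrow> 's) \<Rightarrow> (nat \<Rightarrow> nat \<Rightarrow> 's) \<Rightarrow> bool" where
  "agree L x y \<longleftrightarrow> (\<forall>n<L. x n L = y n L)"

lemma agree_refl: "agree L x x"
  by (simp add: agree_def)

lemma agree_sym: "agree L x y \<Longrightarrow> agree L y x"
  by (simp add: agree_def)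

lemma agree_trans: "agree L x y \<Longrightarrow> agree L y z \<Longrightarrow> agree L x z"
  by (simp add: agree_def)

lemma shift_funpow: "(shift ^^ k) x n = x (k + n)"
  by (induction k arbitrary: n) (simp_all add: shift_def)

locale inverse_limit_orbit =
  fixes S :: "nat \<Rightarrow> 's set"
    and \<psi> :: "nat \<Rightarrow> nat \<Rightarrow> 's \<Rightarrow> 's"
    and u :: "nat \<Rightarrow> nat \<Rightarrow> 's"
  assumes finite_S: "\<And>\<alpha>. finite (S \<alpha>)"
    and u_in: "\<And>n. u n \<in> inverse_limit S \<psi>"
begin

section \<open>Agreement neighbourhoods and compactness of the sequence space\<close>

abbreviation "lim_set \<equiv> inverse_limit S \<psi>"
abbreviation "lim_top \<equiv> inverse_limit_topology S \<psi>"
abbreviation "seq_top \<equiv> sequence_topology lim_top"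

lemma lim_set_in_S: "s \<in> lim_set \<Longrightarrow> s \<alpha> \<in> S \<alpha>"
  by (simp add: inverse_limit_def)

text \<open>The coordinate at \<open>L\<close> is the image under \<open>\<psi> L L'\<close> of the
  coordinate at \<open>L'\<close>.\<close>

lemma lim_set_determined:
  assumes "s \<in> lim_set" "t \<in> lim_set" "s L' = t L'" "L \<le> L'"
  shows "s L = t L"
  using assms unfolding inverse_limit_def by (metis (mono_tags, lifting) mem_Collect_eq)

lemma topspace_lim_top: "topspace lim_top = lim_set"
  by (auto simp: inverse_limit_topology_def inverse_limit_def)

lemma topspace_seq_top: "topspace seq_top = {x. \<forall>n. x n \<in> lim_set}"
  by (auto simp: sequence_topology_def topspace_lim_top)

lemma openin_lim_level: "openin lim_top {t \<in> lim_set. t L = a}"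
proof -
  let ?P = "product_topology (\<lambda>\<alpha>. discrete_topology (S \<alpha>)) UNIV"
  have "continuous_map ?P (discrete_topology (S L)) (\<lambda>t. t L)"
    by (rule continuous_map_product_projection) simp
  then have "openin ?P {t \<in> topspace ?P. t L \<in> {a} \<inter> S L}"
    by (rule openin_continuous_map_preimage) simp
  then have "openin lim_top ({t \<in> topspace ?P. t L \<in> {a} \<inter> S L} \<inter> lim_set)"
    unfolding inverse_limit_topology_def openin_subtopology by blast
  moreover have "{t \<in> topspace ?P. t L \<in> {a} \<inter> S L} \<inter> lim_set = {t \<in> lim_set. t L = a}"
    by (auto simp: inverse_limit_def)
  ultimately show ?thesis by simp
qed

text \<open>A basic open set of the product restricts finitely many coordinates; the coordinate at a
  level above all of these determines them.\<close>

lemma openin_lim_top_neighbourhood: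
  assumes U: "openin lim_top U" and s: "s \<in> U"
  shows "\<exists>L. \<forall>t\<in>lim_set. t L = s L \<longrightarrow> t \<in> U"
proof -
  obtain V where V: "openin (product_topology (\<lambda>\<alpha>. discrete_topology (S \<alpha>)) UNIV) V"
    and UV: "U = V \<inter> lim_set"
    using U unfolding inverse_limit_topology_def openin_subtopology by auto
  obtain W where fin: "finite {\<alpha>. W \<alpha> \<noteq> S \<alpha>}" and W: "s \<in> Pi\<^sub>E UNIV W" "Pi\<^sub>E UNIV W \<subseteq> V"
    using V s UV unfolding openin_product_topology_alt by force
  obtain L where L: "\<And>\<alpha>. W \<alpha> \<noteq> S \<alpha> \<Longrightarrow> \<alpha> \<le> L"
    using fin[unfolded finite_nat_set_iff_bounded_le] by auto
  have "t \<in> U" if t: "t \<in> lim_set" "t L = s L" for t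
  proof -
    have sl: "s \<in> lim_set" using s UV by simp
    have "t \<alpha> \<in> W \<alpha>" for \<alpha>
    proof (cases "W \<alpha> = S \<alpha>")
      case True
      then show ?thesis using t lim_set_in_S by simp
    next
      case False
      then have "t \<alpha> = s \<alpha>" using L lim_set_determined[OF t(1) sl t(2)] by simp
      then show ?thesis using W by auto
    qed
    then show ?thesis using W t UV by auto
  qed
  then show ?thesis by blast
qed

lemma agreeD:
  assumes "agree L' x y" "x \<in> topspace seq_top" "y \<in> topspace seq_top" "n < L'" "L \<le> L'"
  shows "x n L = y n L"
  using assms lim_set_determined[of "x n" "y n" L' L] by (simp add: topspace_seq_top agree_def)

lemma agree_mono:
  assumes "agree L' x y" "x \<in> topspace seq_top" "y \<in> topspace seq_top" "L \<le> L'"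
  shows "agree L x y"
  using agreeD[OF assms(1-3)] assms(4) by (simp add: agree_def)

lemma openin_agree:
  assumes x: "x \<in> topspace seq_top"
  shows "openin seq_top {y \<in> topspace seq_top. agree L x y}"
proof -
  have "openin seq_top {y \<in> topspace seq_top. y n \<in> {t \<in> lim_set. t L = x n L}}" for n
  proof -
    have "continuous_map seq_top lim_top (\<lambda>y. y n)"
      unfolding sequence_topology_def by (rule continuous_map_product_projection) simp
    then show ?thesis by (rule openin_continuous_map_preimage[OF _ openin_lim_level])
  qed
  \<comment> \<open>For \<open>L = 0\<close> the indexed intersection is the whole type, hence the
    extra \<open>topspace seq_top\<close> and the case split.\<close>
  then have "openin seq_top (topspace seq_top \<inter> (\<Inter>n<L. {y \<in> topspace seq_top. y n \<in> {t \<in> lim_set. t L = x n L}}))"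
    by (cases "L = 0") (auto intro!: openin_Int openin_Inter)
  moreover have "topspace seq_top \<inter> (\<Inter>n<L. {y \<in> topspace seq_top. y n \<in> {t \<in> lim_set. t L = x n L}})
      = {y \<in> topspace seq_top. agree L x y}"
    by (auto simp: topspace_seq_top agree_def)
  ultimately show ?thesis by simp
qed

lemma openin_seq_top_neighbourhood:
  assumes U: "openin seq_top U" and x: "x \<in> U"
  shows "\<exists>L. \<forall>y\<in>topspace seq_top. agree L x y \<longrightarrow> y \<in> U"
proof -
  obtain W where fin: "finite {n. W n \<noteq> lim_set}" and W: "\<And>n. openin lim_top (W n)"
    and xW: "x \<in> Pi\<^sub>E UNIV W" and WU: "Pi\<^sub>E UNIV W \<subseteq> U"
    using U x unfolding sequence_topology_def openin_product_topology_alt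
    by (force simp: topspace_lim_top)
  have "\<exists>l. \<forall>t\<in>lim_set. t l = x n l \<longrightarrow> t \<in> W n" for n
    using openin_lim_top_neighbourhood[OF W[of n], of "x n"] xW by auto
  then obtain l where l: "\<And>n t. t \<in> lim_set \<Longrightarrow> t (l n) = x n (l n) \<Longrightarrow> t \<in> W n"
    by metis
  obtain m where m: "\<And>n. W n \<noteq> lim_set \<Longrightarrow> n \<le> m"
    using fin[unfolded finite_nat_set_iff_bounded_le] by auto
  \<comment> \<open>A single index above all restricted positions \<open>n \<le> m\<close> and all
    their levels \<open>l n\<close>, which the sum dominates. The successor is there because
    \<open>agree\<close> compares positions strictly below its index.\<close>
  define L where "L = Suc (m + (\<Sum>n\<le>m. l n))"
  have xS: "x \<in> topspace seq_top" using openin_subset[OF U] x by auto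
  have "y \<in> U" if y: "y \<in> topspace seq_top" "agree L x y" for y
  proof -
    have "y n \<in> W n" for n
    proof (cases "W n = lim_set")
      case True
      then show ?thesis using y by (simp add: topspace_seq_top)
    next
      case False
      then have n: "n \<le> m" by (rule m)
      then have "l n \<le> (\<Sum>n\<le>m. l n)" by (intro member_le_sum) auto
      then have "l n \<le> L" "n < L" using n by (simp_all add: L_def)
      then have "y n (l n) = x n (l n)" using agreeD[OF y(2) xS y(1)] by simp
      then show ?thesis using l y by (simp add: topspace_seq_top)
    qed
    then show ?thesis using WU by auto
  qed
  then show ?thesis by blast
qed

text \<open>The inverse limit is cut out of a product of finite discrete spaces by equations between
  continuous maps into a Hausdorff space, so it is closed and compact; Tychonoff's theorem then
  applies to sequences over it.\<close>

lemma compact_seq_top: "compact_space seq_top"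
proof -
  let ?P = "product_topology (\<lambda>\<alpha>. discrete_topology (S \<alpha>)) UNIV"
  have "closedin ?P {s \<in> topspace ?P. \<psi> \<alpha> \<beta> (s \<beta>) = s \<alpha>}" for \<alpha> \<beta>
  proof (rule closedin_continuous_maps_eq)
    show "Hausdorff_space (discrete_topology (UNIV :: 's set))"
      by simp
    have proj: "continuous_map ?P (discrete_topology (S \<gamma>)) (\<lambda>s. s \<gamma>)" for \<gamma>
      by (rule continuous_map_product_projection) simp
    \<comment> \<open>The locale does not confine the values of \<psi> to the state sets, so both
      maps go into the discrete topology on the whole type.\<close>
    show "continuous_map ?P (discrete_topology UNIV) (\<lambda>s. \<psi> \<alpha> \<beta> (s \<beta>))"
      "continuous_map ?P (discrete_topology UNIV) (\<lambda>s. s \<alpha>)"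
      using continuous_map_compose[OF proj, of _ "discrete_topology UNIV" "\<psi> \<alpha> \<beta>"]
        continuous_map_compose[OF proj, of _ "discrete_topology UNIV" "\<lambda>s. s"]
      by (simp_all add: comp_def continuous_map_from_discrete_topology)
  qed
  then have "closedin ?P (\<Inter>(\<alpha>, \<beta>)\<in>{(\<alpha>, \<beta>). \<alpha> \<le> \<beta>}. {s \<in> topspace ?P. \<psi> \<alpha> \<beta> (s \<beta>) = s \<alpha>})"
    by (intro closedin_INT) auto
  moreover have "(\<Inter>(\<alpha>, \<beta>)\<in>{(\<alpha>, \<beta>). \<alpha> \<le> \<beta>}. {s \<in> topspace ?P. \<psi> \<alpha> \<beta> (s \<beta>) = s \<alpha>}) = lim_set"
    by (auto simp: inverse_limit_def PiE_def)
  moreover have "compact_space ?P"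
    by (simp add: compact_space_product_topology compact_space_discrete_topology finite_S)
  ultimately have "compact_space lim_top"
    unfolding inverse_limit_topology_def
    by (intro compact_space_subtopology closedin_compact_space) simp_all
  then show ?thesis
    by (simp add: sequence_topology_def compact_space_product_topology)
qed

section \<open>The orbit closure and the shift on it\<close>

abbreviation "orbit_top \<equiv> orbit_closure_topology lim_top u"

lemma orbit_in: "(shift ^^ k) u \<in> topspace seq_top"
  by (simp add: topspace_seq_top shift_funpow u_in)

text \<open>The agreement sets of a point form a neighbourhood basis, so closure means approximation
  by shifts of \<open>u\<close> at every index.\<close>

lemma topspace_orbit_top:
  "topspace orbit_top = {x \<in> topspace seq_top. \<forall>L. \<exists>k. agree L x ((shift ^^ k) u)}"
proof -
  have "topspace orbit_top = seq_top closure_of {(shift ^^ n) u | n. True}"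
    unfolding orbit_closure_topology_def topspace_subtopology
    using closure_of_subset_topspace by fastforce
  also have "\<dots> = {x \<in> topspace seq_top. \<forall>L. \<exists>k. agree L x ((shift ^^ k) u)}"
  proof (intro set_eqI iffI)
    fix x assume x: "x \<in> seq_top closure_of {(shift ^^ n) u | n. True}"
    then have xS: "x \<in> topspace seq_top" by (simp add: in_closure_of)
    have "\<exists>k. agree L x ((shift ^^ k) u)" for L
    proof -
      have "x \<in> {y \<in> topspace seq_top. agree L x y}" using xS by (simp add: agree_refl)
      with x[unfolded in_closure_of] openin_agree[OF xS, of L]
      have "\<exists>y. y \<in> {(shift ^^ n) u | n. True} \<and> y \<in> {y \<in> topspace seq_top. agree L x y}"
        by (elim conjE allE[of _ "{y \<in> topspace seq_top. agree L x y}"]) simp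
      then show ?thesis by auto
    qed
    then show "x \<in> {x \<in> topspace seq_top. \<forall>L. \<exists>k. agree L x ((shift ^^ k) u)}" using xS by simp
  next
    fix x assume x: "x \<in> {x \<in> topspace seq_top. \<forall>L. \<exists>k. agree L x ((shift ^^ k) u)}"
    show "x \<in> seq_top closure_of {(shift ^^ n) u | n. True}"
      unfolding in_closure_of
    proof (intro conjI allI impI)
      fix U assume "x \<in> U \<and> openin seq_top U"
      then obtain L where "\<forall>y\<in>topspace seq_top. agree L x y \<longrightarrow> y \<in> U"
        using openin_seq_top_neighbourhood by blast
      moreover obtain k where "agree L x ((shift ^^ k) u)" using x by blast
      ultimately show "\<exists>y. y \<in> {(shift ^^ n) u | n. True} \<and> y \<in> U"
        using orbit_in by blast
    qed (use x in simp)
  qed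
  finally show ?thesis .
qed

lemma orbit_top_in_seq: "x \<in> topspace orbit_top \<Longrightarrow> x \<in> topspace seq_top"
  by (simp add: topspace_orbit_top)

lemma orbit_in_orbit_top: "(shift ^^ k) u \<in> topspace orbit_top"
  using orbit_in agree_refl by (auto simp: topspace_orbit_top)

lemma openin_orbit_top:
  "openin orbit_top U \<longleftrightarrow>
     U \<subseteq> topspace orbit_top \<and> (\<forall>x\<in>U. \<exists>L. \<forall>y\<in>topspace orbit_top. agree L x y \<longrightarrow> y \<in> U)"
  (is "?lhs \<longleftrightarrow> ?rhs")
proof
  assume U: ?lhs
  then obtain V where V: "openin seq_top V" "U = V \<inter> (seq_top closure_of {(shift ^^ n) u | n. True})"
    unfolding orbit_closure_topology_def openin_subtopology by auto
  have UV: "U = V \<inter> topspace orbit_top"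
    using V openin_subset[OF V(1)] by (auto simp: orbit_closure_topology_def)
  have "\<exists>L. \<forall>y\<in>topspace orbit_top. agree L x y \<longrightarrow> y \<in> U" if "x \<in> U" for x
    using openin_seq_top_neighbourhood[OF V(1), of x] that orbit_top_in_seq unfolding UV by blast
  then show ?rhs using openin_subset[OF U] by blast
next
  assume U: ?rhs
  then obtain L where L: "\<And>x y. x \<in> U \<Longrightarrow> y \<in> topspace orbit_top \<Longrightarrow> agree (L x) x y \<Longrightarrow> y \<in> U"
    by metis
  \<comment> \<open>Agreement neighbourhoods taken in the full sequence space, so that
    \<open>U\<close> is the trace of an open set.\<close>
  let ?V = "\<Union>x\<in>U. {y \<in> topspace seq_top. agree (L x) x y}"
  have "openin seq_top ?V"
    using U orbit_top_in_seq openin_agree by (intro openin_Union) blast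
  moreover have "U = ?V \<inter> topspace orbit_top"
    using U L orbit_top_in_seq agree_refl by blast
  moreover have "topspace orbit_top \<subseteq> seq_top closure_of {(shift ^^ n) u | n. True}"
    by (simp add: orbit_closure_topology_def)
  moreover have "U \<subseteq> topspace orbit_top" using U by blast
  ultimately show ?lhs
    unfolding orbit_closure_topology_def openin_subtopology topspace_subtopology
    by (intro exI[of _ ?V]) blast
qed

lemma compact_orbit_top: "compact_space orbit_top"
  unfolding orbit_closure_topology_def
  by (intro compact_space_subtopology closedin_compact_space compact_seq_top closedin_closure_of)

text \<open>The shift uses up one letter; the level is tied to the same index and drops along with
  it, by compatibility.\<close>

lemma agree_shift:
  assumes "agree (Suc L) x y" "x \<in> topspace seq_top" "y \<in> topspace seq_top"
  shows "agree L (shift x) (shift y)"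
  using agreeD[OF assms, of _ L] by (simp add: agree_def shift_def)

lemma shift_orbit_top: "shift \<in> topspace orbit_top \<rightarrow> topspace orbit_top"
proof
  fix x assume x: "x \<in> topspace orbit_top"
  have "\<exists>k. agree L (shift x) ((shift ^^ k) u)" for L
  proof -
    obtain k where "agree (Suc L) x ((shift ^^ k) u)" using x by (auto simp: topspace_orbit_top)
    then have "agree L (shift x) ((shift ^^ Suc k) u)"
      using agree_shift[OF _ orbit_top_in_seq[OF x] orbit_in] by simp
    then show ?thesis ..
  qed
  moreover have "shift x \<in> topspace seq_top"
    using orbit_top_in_seq[OF x] by (simp add: topspace_seq_top shift_def)
  ultimately show "shift x \<in> topspace orbit_top" by (simp add: topspace_orbit_top)
qed

text \<open>The sets decided by finitely many letters at a finite level. One implication is enough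
  because \<open>agree\<close> is symmetric.\<close>

definition cylinder_algebra :: "(nat \<Rightarrow> nat \<Rightarrow> 's) set set" where
  "cylinder_algebra = {A. A \<subseteq> topspace orbit_top \<and>
     (\<exists>L. \<forall>x\<in>topspace orbit_top. \<forall>y\<in>topspace orbit_top. agree L x y \<longrightarrow> x \<in> A \<longrightarrow> y \<in> A)}"

lemma algebra_cylinder_algebra: "algebra (topspace orbit_top) cylinder_algebra"
  unfolding algebra_iff_Un
proof (intro conjI ballI)
  show "cylinder_algebra \<subseteq> Pow (topspace orbit_top)" "{} \<in> cylinder_algebra"
    by (auto simp: cylinder_algebra_def)
next
  fix A assume "A \<in> cylinder_algebra"
  then show "topspace orbit_top - A \<in> cylinder_algebra"
    unfolding cylinder_algebra_def using agree_sym by blast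
next
  fix A B assume "A \<in> cylinder_algebra" "B \<in> cylinder_algebra"
  then obtain K L
    where AB: "A \<subseteq> topspace orbit_top" "B \<subseteq> topspace orbit_top"
      and K: "\<And>x y. x \<in> topspace orbit_top \<Longrightarrow> y \<in> topspace orbit_top \<Longrightarrow> agree K x y \<Longrightarrow> x \<in> A \<Longrightarrow> y \<in> A"
      and L: "\<And>x y. x \<in> topspace orbit_top \<Longrightarrow> y \<in> topspace orbit_top \<Longrightarrow> agree L x y \<Longrightarrow> x \<in> B \<Longrightarrow> y \<in> B"
    unfolding cylinder_algebra_def by blast
  have "y \<in> A \<union> B" if "x \<in> topspace orbit_top" "y \<in> topspace orbit_top" "agree (max K L) x y" "x \<in> A \<union> B" for x y
    using that K[of x y] L[of x y] agree_mono[OF that(3)] orbit_top_in_seq by auto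
  then show "A \<union> B \<in> cylinder_algebra"
    using AB unfolding cylinder_algebra_def by blast
qed

lemma cylinder_algebra_open: "A \<in> cylinder_algebra \<Longrightarrow> openin orbit_top A"
  unfolding openin_orbit_top cylinder_algebra_def by blast

lemma open_in_sigma_cylinder_algebra:
  assumes U: "openin orbit_top U"
  shows "U \<in> sigma_sets (topspace orbit_top) cylinder_algebra"
proof -
  \<comment> \<open>The points whose whole agreement class at index \<open>L\<close> lies in
    \<open>U\<close>. Transitivity of \<open>agree\<close> puts \<open>V L\<close> into the algebra,
    and countably many indices exhaust \<open>U\<close>.\<close>
  define V where "V L = {x \<in> topspace orbit_top. \<forall>y\<in>topspace orbit_top. agree L x y \<longrightarrow> y \<in> U}" for L
  have "V L \<in> cylinder_algebra" for L
    unfolding cylinder_algebra_def V_def using agree_trans by blast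
  then have "(\<Union>L. V L) \<in> sigma_sets (topspace orbit_top) cylinder_algebra"
    by (intro sigma_sets.Union sigma_sets.Basic)
  moreover have "U = (\<Union>L. V L)"
    using U agree_refl unfolding openin_orbit_top V_def by blast
  ultimately show ?thesis by simp
qed

lemma shift_preimage_cylinder_algebra:
  assumes "A \<in> cylinder_algebra"
  shows "shift -` A \<inter> topspace orbit_top \<in> cylinder_algebra"
proof -
  obtain L where L: "\<And>x y. x \<in> topspace orbit_top \<Longrightarrow> y \<in> topspace orbit_top \<Longrightarrow> agree L x y \<Longrightarrow> x \<in> A \<Longrightarrow> y \<in> A"
    using assms unfolding cylinder_algebra_def by blast
  have "shift y \<in> A"
    if "x \<in> topspace orbit_top" "y \<in> topspace orbit_top" "agree (Suc L) x y" "shift x \<in> A" for x y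
    using that L[OF _ _ agree_shift[OF that(3)]] shift_orbit_top orbit_top_in_seq by blast
  then show ?thesis unfolding cylinder_algebra_def by blast
qed

text \<open>Any finite stretch of the orbit of a point in the closure is imitated by
  \<open>u\<close> from some position \<open>m\<close>; uniformity over starting positions therefore
  gives uniformity over points.\<close>

lemma cylinder_uniform_mean:
  fixes p :: nat
  assumes p: "p \<ge> 2"
    and blocks: "\<And>L n j j' i. u j L = u j' L \<Longrightarrow> i < p ^ n \<Longrightarrow> u (p ^ n * j + i) L = u (p ^ n * j' + i) L"
    and letters: "\<And>L. \<exists>k. \<forall>j j'. \<exists>i<p ^ k. u (p ^ k * j' + i) L = u j L"
    and A: "A \<in> cylinder_algebra"
  shows "\<exists>c. \<forall>\<epsilon>>0. \<exists>N\<^sub>0. \<forall>N\<ge>N\<^sub>0. \<forall>x\<in>topspace orbit_top.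
    \<bar>(\<Sum>k<N. indicator A ((shift ^^ k) x)) - real N * c\<bar> \<le> \<epsilon> * real N"
proof -
  obtain L where L: "\<And>x y. x \<in> topspace orbit_top \<Longrightarrow> y \<in> topspace orbit_top \<Longrightarrow> agree L x y \<Longrightarrow> x \<in> A \<Longrightarrow> y \<in> A"
    using A unfolding cylinder_algebra_def by blast
  have ind: "indicator A x = (indicator A y :: real)"
    if "x \<in> topspace orbit_top" "y \<in> topspace orbit_top" "agree L x y" for x y
    using L[OF that] L[OF that(2,1) agree_sym[OF that(3)]] by (auto simp: indicator_def)
  define h where "h k = (indicator A ((shift ^^ k) u) :: real)" for k
  obtain r where r: "\<And>j j'. \<exists>i<p ^ r. u (p ^ r * j' + i) L = u j L"
    using letters[of L] by blast
  have "\<exists>c. has_uniform_mean h c"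
  proof (rule has_uniform_mean_if_primitive[OF p, where w = "\<lambda>j. u j L" and L = L and k = r])
    show "0 \<le> h k" "h k \<le> 1" for k by (simp_all add: h_def)
    show "h (p ^ n * j + i) = h (p ^ n * j' + i)"
      if "u j L = u j' L" "i + L \<le> p ^ n" for n i j j'
    proof -
      have "agree L ((shift ^^ (p ^ n * j + i)) u) ((shift ^^ (p ^ n * j' + i)) u)"
        unfolding agree_def shift_funpow
      proof (intro allI impI)
        fix m assume "m < L"
        then have "u (p ^ n * j + (i + m)) L = u (p ^ n * j' + (i + m)) L"
          using that by (intro blocks) auto
        then show "u (p ^ n * j + i + m) L = u (p ^ n * j' + i + m) L"
          by (simp only: add.assoc)
      qed
      then show ?thesis unfolding h_def by (intro ind orbit_in_orbit_top)
    qed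
  qed (rule r)
  then obtain c where c: "has_uniform_mean h c" ..
  show ?thesis
  proof (intro exI[of _ c] allI impI)
    fix \<epsilon> :: real assume "\<epsilon> > 0"
    then obtain N\<^sub>0 where N0: "\<And>N m. N \<ge> N\<^sub>0 \<Longrightarrow> \<bar>(\<Sum>k<N. h (m + k)) - real N * c\<bar> \<le> \<epsilon> * real N"
      using c unfolding has_uniform_mean_def by blast
    have "\<bar>(\<Sum>k<N. indicator A ((shift ^^ k) x)) - real N * c\<bar> \<le> \<epsilon> * real N"
      if N: "N \<ge> N\<^sub>0" and x: "x \<in> topspace orbit_top" for N x
    proof -
      \<comment> \<open>The first \<open>N\<close> shifts of \<open>x\<close>, each read through
        \<open>L\<close> letters, involve only positions below \<open>N + L\<close>.\<close>
      obtain m where m: "agree (N + L) x ((shift ^^ m) u)"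
        using x by (auto simp: topspace_orbit_top)
      have "indicator A ((shift ^^ k) x) = h (m + k)" if k: "k < N" for k
        unfolding h_def
      proof (rule ind)
        show "(shift ^^ k) x \<in> topspace orbit_top"
          by (induction k) (use x shift_orbit_top in auto)
        show "(shift ^^ (m + k)) u \<in> topspace orbit_top" by (rule orbit_in_orbit_top)
        show "agree L ((shift ^^ k) x) ((shift ^^ (m + k)) u)"
          unfolding agree_def shift_funpow
        proof (intro allI impI)
          fix n assume "n < L"
          then show "x (k + n) L = u (m + k + n) L"
            using agreeD[OF m orbit_top_in_seq[OF x] orbit_in, of "k + n" L] k
            by (simp add: shift_funpow add.assoc)
        qed
      qed
      then have "(\<Sum>k<N. indicator A ((shift ^^ k) x)) = (\<Sum>k<N. h (m + k))"
        by (intro sum.cong) auto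
      then show ?thesis using N0[OF N] by simp
    qed
    then show "\<exists>N\<^sub>0. \<forall>N\<ge>N\<^sub>0. \<forall>x\<in>topspace orbit_top.
        \<bar>(\<Sum>k<N. indicator A ((shift ^^ k) x)) - real N * c\<bar> \<le> \<epsilon> * real N"
      by blast
  qed
qed

end

section \<open>Fixed points of constant-length substitutions\<close>

text \<open>The block of order \<open>n\<close> at \<open>j\<close> is the \<open>n\<close>-th
  iterate of \<theta> on \<open>w j\<close>. The induction uses that position \<open>i\<close> of
  the block of order \<open>n + 1\<close> is letter \<open>i mod p\<close> of the image of position
  \<open>i div p\<close> of the block of order \<open>n\<close>.\<close>

lemma subst_fixpoint_block_cong:
  assumes fixpoint: "subst_seq p \<theta> w = w"
    and "w j = w j'" "i < p ^ n"
  shows "w (p ^ n * j + i) = w (p ^ n * j' + i)"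
  using assms(3)
proof (induction n arbitrary: i)
  case 0
  then show ?case using assms(2) by simp
next
  case (Suc n)
  have p: "p > 0" using Suc.prems by (cases p) auto
  have rec: "w (p ^ Suc n * l + i) = \<theta> (w (p ^ n * l + i div p)) ! (i mod p)" for l
  proof -
    have split: "p ^ Suc n * l + i = p * (p ^ n * l) + i" by simp
    have "w (p ^ Suc n * l + i) = \<theta> (w ((p ^ Suc n * l + i) div p)) ! ((p ^ Suc n * l + i) mod p)"
      using fun_cong[OF fixpoint, of "p ^ Suc n * l + i"] by (simp add: subst_seq_def)
    also have "\<dots> = \<theta> (w (p ^ n * l + i div p)) ! (i mod p)"
      unfolding split using p by simp
    finally show ?thesis .
  qed
  have "i div p < p ^ n" using Suc.prems by (simp add: less_mult_imp_div_less mult.commute)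
  then show ?case unfolding rec using Suc.IH by simp
qed

text \<open>Links primitivity, which concerns iterated words, to occurrences in \<open>w\<close>:
  the iterated word is read off along the aligned block, so its letters occur there.\<close>

lemma subst_fixpoint_iterate_letters:
  assumes fixpoint: "subst_seq p \<theta> w = w"
    and len: "\<And>n. length (\<theta> (w n)) = p"
  shows "set ((subst_word \<theta> ^^ k) [w j]) \<subseteq> {w (p ^ k * j + i) | i. i < p ^ k}"
proof (induction k)
  case (Suc k)
  show ?case
  proof
    fix b assume "b \<in> set ((subst_word \<theta> ^^ Suc k) [w j])"
    then obtain a where "a \<in> set ((subst_word \<theta> ^^ k) [w j])" and b: "b \<in> set (\<theta> a)"
      by (auto simp: subst_word_def)
    then obtain i where i: "i < p ^ k" "a = w (p ^ k * j + i)" using Suc.IH by blast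
    then obtain l where l: "l < p" "b = \<theta> (w (p ^ k * j + i)) ! l"
      using b len by (auto simp: in_set_conv_nth)
    have "w (p * (p ^ k * j + i) + l) = b"
      using fun_cong[OF fixpoint, of "p * (p ^ k * j + i) + l"] l by (simp add: subst_seq_def)
    then have "b = w (p ^ Suc k * j + (p * i + l))" by (simp add: algebra_simps)
    moreover have "p * i + l < p ^ Suc k"
    proof -
      have "p * Suc i \<le> p * p ^ k" using i by (intro mult_left_mono) auto
      then show ?thesis using l by simp
    qed
    ultimately show "b \<in> {w (p ^ Suc k * j + i) | i. i < p ^ Suc k}" by blast
  qed
qed simp

theorem corollary4p6:
  fixes p :: nat
    and S :: "nat \<Rightarrow> 's set"
    and \<delta> :: "nat \<Rightarrow> 's \<Rightarrow> nat \<Rightarrow> 's"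
    and s0 :: "nat \<Rightarrow> 's"
    and \<tau> :: "nat \<Rightarrow> 's \<Rightarrow> nat"
    and \<psi> :: "nat \<Rightarrow> nat \<Rightarrow> 's \<Rightarrow> 's"
    and \<theta> :: "nat \<Rightarrow> 's \<Rightarrow> 's list"
    and u :: "nat \<Rightarrow> (nat \<Rightarrow> 's)"
  assumes "prime p"
    and "inverse_automata_family p S \<delta> s0 \<tau> \<psi>"
    and "\<And>\<alpha>. \<theta> \<alpha> = automaton_subst p (\<delta> \<alpha>)"
    and "\<And>n. u n \<in> inverse_limit S \<psi>"
    and "subst_seq p (profinite_subst p \<theta>) u = u"
    and "\<And>\<alpha>. length_subst p (S \<alpha>) (\<theta> \<alpha>)"
    and "\<And>\<alpha>. primitive_subst (S \<alpha>) (\<theta> \<alpha>)"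
  shows "uniquely_ergodic (orbit_closure_topology (inverse_limit_topology S \<psi>) u) shift"
proof -
  interpret inverse_limit_orbit S \<psi> u
  proof
    show "finite (S \<alpha>)" for \<alpha>
      using inverse_automata_family.automaton[OF assms(2)] by (rule finite_automaton.finite_states)
  qed (rule assms(4))
  have p: "p \<ge> 2" using assms(1) by (rule prime_ge_2_nat)
  have letter_in: "u n \<alpha> \<in> S \<alpha>" for n \<alpha>
    using lim_set_in_S assms(4) .
  \<comment> \<open>The profinite substitution acts coordinatewise, so projecting to level \<alpha>
    turns \<open>u\<close> into a fixed point of \<open>\<theta> \<alpha>\<close>.\<close>
  have fixpoint: "subst_seq p (\<theta> \<alpha>) (\<lambda>n. u n \<alpha>) = (\<lambda>n. u n \<alpha>)" for \<alpha>
  proof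
    fix n
    have "u n \<alpha> = (profinite_subst p \<theta> (u (n div p)) ! (n mod p)) \<alpha>"
      using fun_cong[OF assms(5), of n] by (simp add: subst_seq_def)
    also have "\<dots> = \<theta> \<alpha> (u (n div p) \<alpha>) ! (n mod p)"
      using p by (simp add: profinite_subst_def)
    finally show "subst_seq p (\<theta> \<alpha>) (\<lambda>n. u n \<alpha>) n = u n \<alpha>" by (simp add: subst_seq_def)
  qed
  \<comment> \<open>The exponent of primitivity at level \<open>L\<close> works for all blocks at
    once: the block at \<open>j'\<close> carries the iterate of the letter at \<open>j'\<close>,
    which contains every state and in particular the letter at \<open>j\<close>.\<close>
  have letters: "\<exists>k. \<forall>j j'. \<exists>i<p ^ k. u (p ^ k * j' + i) L = u j L" for L
  proof -
    obtain k where k: "\<And>a a'. a \<in> S L \<Longrightarrow> a' \<in> S L \<Longrightarrow> a' \<in> set ((subst_word (\<theta> L) ^^ k) [a])"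
      using assms(7)[of L] unfolding primitive_subst_def by blast
    have len: "length (\<theta> L (u n L)) = p" for n
      using assms(6)[of L] letter_in unfolding length_subst_def by blast
    have "\<exists>i<p ^ k. u (p ^ k * j' + i) L = u j L" for j j'
      using subst_fixpoint_iterate_letters[OF fixpoint len, of k j'] k[OF letter_in[of j'] letter_in[of j]]
      by fastforce
    then show ?thesis by blast
  qed
  show ?thesis
  proof (rule uniquely_ergodicI[where M = cylinder_algebra])
    show "topspace orbit_top \<noteq> {}" using orbit_in_orbit_top by blast
    fix A assume "A \<in> cylinder_algebra"
    then show "\<exists>c. \<forall>\<epsilon>>0. \<exists>N\<^sub>0. \<forall>N\<ge>N\<^sub>0. \<forall>x\<in>topspace orbit_top.
        \<bar>(\<Sum>k<N. indicator A ((shift ^^ k) x)) - real N * c\<bar> \<le> \<epsilon> * real N"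
      using subst_fixpoint_block_cong[OF fixpoint] letters
      by (intro cylinder_uniform_mean[OF p]) blast+
  qed (use compact_orbit_top algebra_cylinder_algebra cylinder_algebra_open
      open_in_sigma_cylinder_algebra shift_orbit_top shift_preimage_cylinder_algebra in blast)+
qed

end
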